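(* Let $\mathcal{N}$ be a smooth manifold without boundary, equipped with the diffeology whose plots are the smooth maps $U\to\mathcal{N}$ from arbitrary domains $U$, and let $Bar$ be equipped with its canonical diffeology $\mathcal{D}(Bar)$. Then the smooth maps of diffeological spaces from $Bar$ to $\mathcal{N}$ are exactly the maps $Bar\to\mathcal{N}$ that are $\infty$-differentiable (at every barcode in $Bar$).
   Context: Barcodes: a barcode is a multiset $D=D'\cup\Delta^\infty$, where $D'$ is a finite multiset of elements of $\mathbb{R}\times(\mathbb{R}\cup\{+\infty\})$ and $\Delta^\infty$ consists of the diagonal $\Delta=\{(b,b)\mid b\in\mathbb{R}\}$ with countably infinite multiplicity. $Bar$ is the set of barcodes. For $m,n\in\mathbb{N}$, $Q_{m,n}:\mathbb{R}^{2m}\times\mathbb{R}^n\to Bar$ is $Q_{m,n}(b_1,d_1,\dots,b_m,d_m,v_1,\dots,v_n)=\{(b_i,d_i)\}_{i=1}^m\cup\{(v_j,+\infty)\}_{j=1}^n\cup\Delta^\infty$. A map $V:Bar\to\mathcal{N}$ is $\infty$-differentiable at $D\in Bar$ if for all $m,n\in\mathbb{N}$ and all $\tilde D\in\mathbb{R}^{2m}\times\mathbb{R}^n$ with $Q_{m,n}(\tilde D)=D$, the map $V\circ Q_{m,n}:\mathbb{R}^{2m}\times\mathbb{R}^n\to\mathcal{N}$ is $C^\infty$ on an open neighborhood of $\tilde D$. A domain is an open subset of some Euclidean space. A diffeology on a nonempty set $S$ is a collection of maps $P:U\to S$ from domains $U$ (called plots) such that: all constant maps $\mathbb{R}^n\to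 S$ are plots; a map $P:U\to S$ that restricts to a plot on a neighborhood of each point of $U$ is a plot; and $P\circ F$ is a plot for every plot $P:U\to S$ and every smooth map $F:W\to U$ with $W$ a domain. A map between diffeological spaces is smooth if its composition with every plot of the source is a plot of the target. A diffeology is finer than another if it is contained in it. Each $\mathbb{R}^{2m+n}$ carries its Euclidean diffeology (plots are the $C^\infty$ maps from domains). The sum diffeology on $\bigsqcup_{m,n\in\mathbb{N}}\mathbb{R}^{2m+n}$ is the finest diffeology making all the inclusions smooth. As a set, $Bar\cong\big(\bigsqcup_{m,n\in\mathbb{N}}\mathbb{R}^{2m+n}\big)/\!\sim$, where two ordered barcodes are equivalent if and only if they have the same image under the maps $Q_{m,n}$. The canonical diffeology $\mathcal{D}(Bar)$ is the quotient diffeology, that is, the finest diffeology on $Bar$ making the quotient map $\bigsqcup_{m,n}\mathbb{R}^{2m+n}\to Bar$ smooth. *)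

theory Defs
  imports "HOL-Analysis.Analysis" "HOL-Library.Multiset"
begin

section \<open>Smooth functions on domains\<close>

text \<open>
  Diffeologies quantify over the dimension of a domain, so the points of k-dimensional Euclidean
  space are those of the library's \<open>Euclidean_space k\<close>: sequences \<open>nat \<Rightarrow> real\<close> vanishing from
  index k on. A domain of dimension k is a set that is open in \<open>Euclidean_space k\<close>.
\<close>

abbreviation Rn :: "nat \<Rightarrow> (nat \<Rightarrow> real) set" where
  "Rn k \<equiv> topspace (Euclidean_space k)"

definition partial_deriv :: "nat \<Rightarrow> ((nat \<Rightarrow> real) \<Rightarrow> real) \<Rightarrow> (nat \<Rightarrow> real) \<Rightarrow> real" where
  "partial_deriv i f x = deriv (\<lambda>t. f (x(i := t))) (x i)"

text \<open>\<open>Ck_on r k U f\<close>: all partial derivatives of order at most r of the real function f exist and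
  are continuous on the domain U of dimension k.\<close>

primrec Ck_on ::
    "nat \<Rightarrow> nat \<Rightarrow> (nat \<Rightarrow> real) set \<Rightarrow> ((nat \<Rightarrow> real) \<Rightarrow> real) \<Rightarrow> bool" where
  "Ck_on 0 k U f \<longleftrightarrow> continuous_map (subtopology (Euclidean_space k) U) euclideanreal f"
| "Ck_on (Suc r) k U f \<longleftrightarrow>
     continuous_map (subtopology (Euclidean_space k) U) euclideanreal f \<and>
     (\<forall>i<k. (\<forall>x\<in>U. (\<lambda>t. f (x(i := t))) differentiable (at (x i))) \<and>
            Ck_on r k U (partial_deriv i f))"

definition smooth_on ::
    "nat \<Rightarrow> (nat \<Rightarrow> real) set \<Rightarrow> nat \<Rightarrow> ((nat \<Rightarrow> real) \<Rightarrow> nat \<Rightarrow> real) \<Rightarrow> bool" where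
  "smooth_on k U l F \<longleftrightarrow> F ` U \<subseteq> Rn l \<and> (\<forall>j<l. \<forall>r. Ck_on r k U (\<lambda>x. F x j))"


section \<open>Smooth manifolds without boundary\<close>

text \<open>A chart \<open>(W, \<phi>)\<close> is an open set W together with a homeomorphism \<open>\<phi>\<close> of W onto a domain;
  only the values of \<open>\<phi>\<close> on W matter. The smooth structure is given by any smooth atlas; it need
  not be maximal.\<close>

type_synonym 'a chart = "'a set \<times> ('a \<Rightarrow> nat \<Rightarrow> real)"

definition is_chart :: "nat \<Rightarrow> 'a topology \<Rightarrow> 'a chart \<Rightarrow> bool" where
  "is_chart d X = (\<lambda>(W, \<phi>). openin X W \<and> openin (Euclidean_space d) (\<phi> ` W) \<and>
     homeomorphic_map (subtopology X W) (subtopology (Euclidean_space d) (\<phi> ` W)) \<phi>)"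

definition smooth_atlas :: "nat \<Rightarrow> 'a topology \<Rightarrow> 'a chart set \<Rightarrow> bool" where
  "smooth_atlas d X A \<longleftrightarrow>
     (\<forall>c\<in>A. is_chart d X c) \<and>
     (\<Union>(W, \<phi>)\<in>A. W) = topspace X \<and>
     (\<forall>(W, \<phi>)\<in>A. \<forall>(W', \<phi>')\<in>A. smooth_on d (\<phi> ` (W \<inter> W')) d (\<phi>' \<circ> inv_into W \<phi>))"

definition second_countable_space :: "'a topology \<Rightarrow> bool" where
  "second_countable_space X \<longleftrightarrow>
     (\<exists>\<B>. countable \<B> \<and> (\<forall>B\<in>\<B>. openin X B) \<and>
        (\<forall>U x. openin X U \<and> x \<in> U \<longrightarrow> (\<exists>B\<in>\<B>. x \<in> B \<and> B \<subseteq> U)))"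

definition smooth_manifold :: "nat \<Rightarrow> 'a topology \<Rightarrow> 'a chart set \<Rightarrow> bool" where
  "smooth_manifold d X A \<longleftrightarrow>
     Hausdorff_space X \<and> second_countable_space X \<and> smooth_atlas d X A"

text \<open>Smoothness on a domain U of dimension k of a map into a manifold with atlas A, read in charts
  of A; continuity is built in, as the chart domain W has to contain the image of a neighbourhood.\<close>

definition manifold_smooth_on ::
    "nat \<Rightarrow> 'a chart set \<Rightarrow> nat \<Rightarrow> (nat \<Rightarrow> real) set \<Rightarrow> ((nat \<Rightarrow> real) \<Rightarrow> 'a) \<Rightarrow> bool" where
  "manifold_smooth_on d A k U F \<longleftrightarrow>
     (\<forall>x\<in>U. \<exists>O'. openin (Euclidean_space k) O' \<and> x \<in> O' \<and> O' \<subseteq> U \<and>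
        (\<exists>(W, \<phi>)\<in>A. F ` O' \<subseteq> W \<and> smooth_on k O' d (\<phi> \<circ> F)))"


section \<open>Diffeologies\<close>

text \<open>A parametrization \<open>(k, U, P)\<close> stands for a map P defined on the domain U of dimension k.
  In the plots below, P is extensional (\<open>undefined\<close> outside U), so that equality of
  parametrizations is equality of maps on U and inclusion of sets of plots is the relation
  ``finer''.\<close>

type_synonym 's parametrization = "nat \<times> (nat \<Rightarrow> real) set \<times> ((nat \<Rightarrow> real) \<Rightarrow> 's)"

definition parametrizations :: "'s set \<Rightarrow> 's parametrization set" where
  "parametrizations S = {(k, U, P). openin (Euclidean_space k) U \<and> P \<in> U \<rightarrow>\<^sub>E S}"

definition diffeology :: "'s set \<Rightarrow> 's parametrization set \<Rightarrow> bool" where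
  "diffeology S D \<longleftrightarrow>
     S \<noteq> {} \<and>
     D \<subseteq> parametrizations S \<and>
     (\<forall>k. \<forall>s\<in>S. (k, Rn k, \<lambda>x\<in>Rn k. s) \<in> D) \<and>
     (\<forall>(k, U, P) \<in> parametrizations S.
        (\<forall>x\<in>U. \<exists>O'. openin (Euclidean_space k) O' \<and> x \<in> O' \<and> O' \<subseteq> U \<and>
                    (k, O', restrict P O') \<in> D)
        \<longrightarrow> (k, U, P) \<in> D) \<and>
     (\<forall>(k, U, P) \<in> D. \<forall>l W F.
        openin (Euclidean_space l) W \<and> F ` W \<subseteq> U \<and> smooth_on l W k F
        \<longrightarrow> (l, W, compose W P F) \<in> D)"

definition smooth_maps ::
    "'s set \<Rightarrow> 's parametrization set \<Rightarrow> 't set \<Rightarrow> 't parametrization set \<Rightarrow> ('s \<Rightarrow> 't) set" where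
  "smooth_maps S D T E = {f \<in> S \<rightarrow>\<^sub>E T. \<forall>(k, U, P) \<in> D. (k, U, compose U f P) \<in> E}"

text \<open>The finest diffeology on S satisfying \<open>\<Phi>\<close>. As an intersection of diffeologies on S is a
  diffeology, it is the intersection of all of them whenever \<open>\<Phi>\<close> is stable under intersections; see
  \<open>sum_diffeology_finest\<close> and \<open>Bar_diffeology_finest\<close> below.\<close>

definition finest_diffeology ::
    "'s set \<Rightarrow> ('s parametrization set \<Rightarrow> bool) \<Rightarrow> 's parametrization set" where
  "finest_diffeology S \<Phi> = \<Inter>{D. diffeology S D \<and> \<Phi> D}"

definition euclidean_diffeology :: "nat \<Rightarrow> (nat \<Rightarrow> real) parametrization set" where
  "euclidean_diffeology l = {(k, U, P) \<in> parametrizations (Rn l). smooth_on k U l P}"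

definition manifold_diffeology ::
    "nat \<Rightarrow> 'a topology \<Rightarrow> 'a chart set \<Rightarrow> 'a parametrization set" where
  "manifold_diffeology d X A =
     {(k, U, P) \<in> parametrizations (topspace X). manifold_smooth_on d A k U P}"


section \<open>Barcodes\<close>

text \<open>Since the diagonal has infinite multiplicity, a barcode is represented by its multiplicity
  function with values in \<open>enat\<close>. Of the extended reals only those other than \<open>-\<infinity>\<close> may occur as
  second coordinates.\<close>

type_synonym barcode = "real \<times> ereal \<Rightarrow> enat"

definition diagonal_inf :: barcode where
  "diagonal_inf p = (if p \<in> {(b, ereal b) | b. True} then \<infinity> else 0)"

definition barcode_of_mset :: "(real \<times> ereal) multiset \<Rightarrow> barcode" where
  "barcode_of_mset M = (\<lambda>p. enat (count M p) + diagonal_inf p)"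

definition Bar :: "barcode set" where
  "Bar = {barcode_of_mset M | M. \<forall>p \<in># M. snd p \<noteq> -\<infinity>}"

text \<open>The coordinates of a point of \<open>Rn (2 * m + n)\<close> are
  \<open>b\<^sub>0, d\<^sub>0, \<dots>, b\<^sub>m\<^sub>-\<^sub>1, d\<^sub>m\<^sub>-\<^sub>1, v\<^sub>0, \<dots>, v\<^sub>n\<^sub>-\<^sub>1\<close>.\<close>

definition Qmap :: "nat \<Rightarrow> nat \<Rightarrow> (nat \<Rightarrow> real) \<Rightarrow> barcode" where
  "Qmap m n x = barcode_of_mset
     (image_mset (\<lambda>i. (x (2 * i), ereal (x (2 * i + 1)))) (mset_set {..<m}) +
      image_mset (\<lambda>j. (x (2 * m + j), \<infinity>)) (mset_set {..<n}))"

definition infinitely_differentiable_at ::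
    "nat \<Rightarrow> 'a chart set \<Rightarrow> (barcode \<Rightarrow> 'a) \<Rightarrow> barcode \<Rightarrow> bool" where
  "infinitely_differentiable_at d A V D \<longleftrightarrow>
     (\<forall>m n. \<forall>x \<in> Rn (2 * m + n). Qmap m n x = D \<longrightarrow>
        (\<exists>U. openin (Euclidean_space (2 * m + n)) U \<and> x \<in> U \<and>
             manifold_smooth_on d A (2 * m + n) U (V \<circ> Qmap m n)))"


section \<open>The canonical diffeology on the set of barcodes\<close>

definition OrdBar :: "((nat \<times> nat) \<times> (nat \<Rightarrow> real)) set" where
  "OrdBar = (SIGMA (m, n) : UNIV. Rn (2 * m + n))"

definition ord_incl :: "nat \<Rightarrow> nat \<Rightarrow> (nat \<Rightarrow> real) \<Rightarrow> (nat \<times> nat) \<times> (nat \<Rightarrow> real)" where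
  "ord_incl m n = (\<lambda>x \<in> Rn (2 * m + n). ((m, n), x))"

definition quotient_map_Bar :: "(nat \<times> nat) \<times> (nat \<Rightarrow> real) \<Rightarrow> barcode" where
  "quotient_map_Bar = (\<lambda>((m, n), x) \<in> OrdBar. Qmap m n x)"

definition sum_diffeology :: "((nat \<times> nat) \<times> (nat \<Rightarrow> real)) parametrization set" where
  "sum_diffeology = finest_diffeology OrdBar (\<lambda>D. \<forall>m n.
     ord_incl m n \<in> smooth_maps (Rn (2 * m + n)) (euclidean_diffeology (2 * m + n)) OrdBar D)"

definition Bar_diffeology :: "barcode parametrization set" where
  "Bar_diffeology = finest_diffeology Bar (\<lambda>D.
     quotient_map_Bar \<in> smooth_maps OrdBar sum_diffeology Bar D)"


lemma diffeologyI:
  assumes "S \<noteq> {}" and "D \<subseteq> parametrizations S"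
    and "\<And>k s. s \<in> S \<Longrightarrow> (k, Rn k, \<lambda>x\<in>Rn k. s) \<in> D"
    and "\<And>k U P. (k, U, P) \<in> parametrizations S \<Longrightarrow>
           (\<And>x. x \<in> U \<Longrightarrow> \<exists>O'. openin (Euclidean_space k) O' \<and> x \<in> O' \<and> O' \<subseteq> U \<and>
                            (k, O', restrict P O') \<in> D) \<Longrightarrow> (k, U, P) \<in> D"
    and "\<And>k U P l W F. (k, U, P) \<in> D \<Longrightarrow> openin (Euclidean_space l) W \<Longrightarrow> F ` W \<subseteq> U \<Longrightarrow>
           smooth_on l W k F \<Longrightarrow> (l, W, compose W P F) \<in> D"
  shows "diffeology S D"
  unfolding diffeology_def
proof (intro conjI)
  show "\<forall>(k, U, P) \<in> parametrizations S.
          (\<forall>x\<in>U. \<exists>O'. openin (Euclidean_space k) O' \<and> x \<in> O' \<and> O' \<subseteq> U \<and>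
                      (k, O', restrict P O') \<in> D) \<longrightarrow> (k, U, P) \<in> D"
    by (clarify, rule assms(4)) simp_all
  show "\<forall>(k, U, P) \<in> D. \<forall>l W F. openin (Euclidean_space l) W \<and> F ` W \<subseteq> U \<and> smooth_on l W k F
          \<longrightarrow> (l, W, compose W P F) \<in> D"
    by (clarify, rule assms(5)) simp_all
qed (use assms(1-3) in auto)

lemma diffeologyD:
  assumes "diffeology S D"
  shows "S \<noteq> {}" and "D \<subseteq> parametrizations S"
    and "\<And>k s. s \<in> S \<Longrightarrow> (k, Rn k, \<lambda>x\<in>Rn k. s) \<in> D"
    and "\<And>k U P. (k, U, P) \<in> parametrizations S \<Longrightarrow>
           (\<And>x. x \<in> U \<Longrightarrow> \<exists>O'. openin (Euclidean_space k) O' \<and> x \<in> O' \<and> O' \<subseteq> U \<and>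
                            (k, O', restrict P O') \<in> D) \<Longrightarrow> (k, U, P) \<in> D"
    and "\<And>k U P l W F. (k, U, P) \<in> D \<Longrightarrow> openin (Euclidean_space l) W \<Longrightarrow> F ` W \<subseteq> U \<Longrightarrow>
           smooth_on l W k F \<Longrightarrow> (l, W, compose W P F) \<in> D"
proof -
  note D = assms[unfolded diffeology_def]
  show "S \<noteq> {}" "D \<subseteq> parametrizations S" "\<And>k s. s \<in> S \<Longrightarrow> (k, Rn k, \<lambda>x\<in>Rn k. s) \<in> D"
    using D by simp_all
  show "(k, U, P) \<in> D" if "(k, U, P) \<in> parametrizations S"
    "\<And>x. x \<in> U \<Longrightarrow> \<exists>O'. openin (Euclidean_space k) O' \<and> x \<in> O' \<and> O' \<subseteq> U \<and>
                            (k, O', restrict P O') \<in> D" for k U P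
    using bspec[OF D[THEN conjunct2, THEN conjunct2, THEN conjunct2, THEN conjunct1] that(1)] that(2)
    by simp
  show "(l, W, compose W P F) \<in> D" if "(k, U, P) \<in> D" "openin (Euclidean_space l) W"
    "F ` W \<subseteq> U" "smooth_on l W k F" for k U P l W F
    using bspec[OF D[THEN conjunct2, THEN conjunct2, THEN conjunct2, THEN conjunct2] that(1)] that(2-)
    by simp
qed

lemma diffeology_coarse:
  assumes "S \<noteq> {}"
  shows "diffeology S (parametrizations S)"
proof (rule diffeologyI)
  fix k U P l W and F :: "(nat \<Rightarrow> real) \<Rightarrow> (nat \<Rightarrow> real)"
  assume "(k, U, P) \<in> parametrizations S" "openin (Euclidean_space l) W" "F ` W \<subseteq> U"
  then show "(l, W, compose W P F) \<in> parametrizations S"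
    by (auto simp: parametrizations_def compose_def PiE_iff image_subset_iff)
qed (use assms in \<open>auto simp: parametrizations_def\<close>)

lemma diffeology_Inter:
  assumes ne: "\<D> \<noteq> {}" and D: "\<And>D. D \<in> \<D> \<Longrightarrow> diffeology S D"
  shows "diffeology S (\<Inter>\<D>)"
proof -
  obtain D0 where D0: "D0 \<in> \<D>" using ne by blast
  show ?thesis
  proof (rule diffeologyI)
    show "S \<noteq> {}" by (rule diffeologyD(1)[OF D[OF D0]])
    show "\<Inter>\<D> \<subseteq> parametrizations S" using diffeologyD(2)[OF D[OF D0]] D0 by blast
    show "(k, Rn k, \<lambda>x\<in>Rn k. s) \<in> \<Inter>\<D>" if "s \<in> S" for k s
      using diffeologyD(3)[OF D that] by blast
  next
    fix k U P
    assume P: "(k, U, P) \<in> parametrizations S"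
      and loc: "\<And>x. x \<in> U \<Longrightarrow> \<exists>O'. openin (Euclidean_space k) O' \<and> x \<in> O' \<and> O' \<subseteq> U \<and>
                  (k, O', restrict P O') \<in> \<Inter>\<D>"
    show "(k, U, P) \<in> \<Inter>\<D>"
    proof
      fix E assume E: "E \<in> \<D>"
      show "(k, U, P) \<in> E"
        by (rule diffeologyD(4)[OF D[OF E] P]) (use loc E in blast)
    qed
  next
    fix k U P l W and F :: "(nat \<Rightarrow> real) \<Rightarrow> (nat \<Rightarrow> real)"
    assume P: "(k, U, P) \<in> \<Inter>\<D>"
      and F: "openin (Euclidean_space l) W" "F ` W \<subseteq> U" "smooth_on l W k F"
    show "(l, W, compose W P F) \<in> \<Inter>\<D>"
    proof
      fix E assume E: "E \<in> \<D>"
      then have "(k, U, P) \<in> E" using P by blast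
      then show "(l, W, compose W P F) \<in> E" by (rule diffeologyD(5)[OF D[OF E] _ F])
    qed
  qed
qed

lemma smooth_maps_coarse:
  assumes "f \<in> S \<rightarrow>\<^sub>E T" and "D \<subseteq> parametrizations S"
  shows "f \<in> smooth_maps S D T (parametrizations T)"
proof -
  have "(k, U, compose U f P) \<in> parametrizations T" if "(k, U, P) \<in> D" for k U P
  proof -
    have "openin (Euclidean_space k) U" "P \<in> U \<rightarrow>\<^sub>E S"
      using that assms(2) by (auto simp: parametrizations_def)
    then show ?thesis
      using assms(1) by (auto simp: parametrizations_def compose_def PiE_iff)
  qed
  then show ?thesis
    using assms(1) by (auto simp: smooth_maps_def)
qed

lemma smooth_maps_Inter:
  assumes "\<D> \<noteq> {}" and "\<And>E. E \<in> \<D> \<Longrightarrow> f \<in> smooth_maps S D T E"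
  shows "f \<in> smooth_maps S D T (\<Inter>\<D>)"
  using assms unfolding smooth_maps_def by fast

lemma sum_diffeology_finest:
  defines "\<Phi> \<equiv> \<lambda>D. \<forall>m n.
     ord_incl m n \<in> smooth_maps (Rn (2 * m + n)) (euclidean_diffeology (2 * m + n)) OrdBar D"
  shows "diffeology OrdBar sum_diffeology" and "\<Phi> sum_diffeology"
    and "\<And>D. diffeology OrdBar D \<Longrightarrow> \<Phi> D \<Longrightarrow> sum_diffeology \<subseteq> D"
proof -
  have "((0, 0), \<lambda>_. 0) \<in> OrdBar"
    by (simp add: OrdBar_def topspace_Euclidean_space)
  then have coarse: "diffeology OrdBar (parametrizations OrdBar)"
    by (intro diffeology_coarse) blast
  have "ord_incl m n \<in> Rn (2 * m + n) \<rightarrow>\<^sub>E OrdBar" for m n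
    by (auto simp: ord_incl_def OrdBar_def)
  then have "\<Phi> (parametrizations OrdBar)"
    unfolding \<Phi>_def by (auto intro!: smooth_maps_coarse simp: euclidean_diffeology_def)
  with coarse have ne: "{D. diffeology OrdBar D \<and> \<Phi> D} \<noteq> {}" by blast
  show "diffeology OrdBar sum_diffeology"
    unfolding sum_diffeology_def finest_diffeology_def \<Phi>_def[symmetric]
    by (rule diffeology_Inter[OF ne]) blast
  show "\<Phi> sum_diffeology"
    unfolding sum_diffeology_def finest_diffeology_def \<Phi>_def[symmetric]
    unfolding \<Phi>_def by (intro allI smooth_maps_Inter ne[unfolded \<Phi>_def]) blast
  show "\<And>D. diffeology OrdBar D \<Longrightarrow> \<Phi> D \<Longrightarrow> sum_diffeology \<subseteq> D"
    unfolding sum_diffeology_def finest_diffeology_def \<Phi>_def[symmetric] by blast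
qed

text \<open>The quotient map is onto, so its fibres identify \<open>Bar\<close> with the set of classes of ordered
  barcodes that have the same image under the maps \<open>Qmap m n\<close>.\<close>

lemma quotient_map_Bar_onto: "quotient_map_Bar ` OrdBar = Bar"
proof
  have "Qmap m n x \<in> Bar" for m n x
    unfolding Qmap_def Bar_def by (rule CollectI, rule exI, rule conjI, rule refl) auto
  then show "quotient_map_Bar ` OrdBar \<subseteq> Bar"
    by (auto simp: quotient_map_Bar_def)
  show "Bar \<subseteq> quotient_map_Bar ` OrdBar"
  proof
    fix D assume "D \<in> Bar"
    then obtain M where M: "D = barcode_of_mset M" "\<forall>p \<in># M. snd p \<noteq> -\<infinity>"
      by (auto simp: Bar_def)
    obtain ps where ps: "mset ps = filter_mset (\<lambda>p. snd p \<noteq> \<infinity>) M" by (meson ex_mset)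
    obtain qs where qs: "mset qs = filter_mset (\<lambda>p. \<not> snd p \<noteq> \<infinity>) M" by (meson ex_mset)
    define m n where "m = length ps" and "n = length qs"
    define x where "x k = (if k < 2 * m
        then (if even k then fst (ps ! (k div 2)) else real_of_ereal (snd (ps ! (k div 2))))
        else if k < 2 * m + n then fst (qs ! (k - 2 * m)) else 0)" for k
    have list: "mset (map f [0..<k]) = image_mset f (mset_set {..<k})"
      for f :: "nat \<Rightarrow> real \<times> ereal" and k
      by (metis atLeast0LessThan mset_map mset_upt)
    have "(x (2 * i), ereal (x (2 * i + 1))) = ps ! i" if "i < m" for i
    proof -
      have "ps ! i \<in># mset ps" using that by (simp add: m_def)
      then have "snd (ps ! i) \<noteq> \<infinity>" "snd (ps ! i) \<noteq> -\<infinity>"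
        unfolding ps using M(2) by auto
      then show ?thesis
        using that by (auto simp: x_def ereal_real prod_eq_iff)
    qed
    then have "map (\<lambda>i. (x (2 * i), ereal (x (2 * i + 1)))) [0..<m] = ps"
      by (intro nth_equalityI) (auto simp: m_def)
    then have 1: "image_mset (\<lambda>i. (x (2 * i), ereal (x (2 * i + 1)))) (mset_set {..<m}) =
                  filter_mset (\<lambda>p. snd p \<noteq> \<infinity>) M"
      using list[of "\<lambda>i. (x (2 * i), ereal (x (2 * i + 1)))" m] by (simp only: ps)
    have "(x (2 * m + j), \<infinity>) = qs ! j" if "j < n" for j
    proof -
      have "qs ! j \<in># mset qs" using that by (simp add: n_def)
      then have "snd (qs ! j) = \<infinity>" unfolding qs by auto
      then show ?thesis
        using that by (simp add: x_def prod_eq_iff)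
    qed
    then have "map (\<lambda>j. (x (2 * m + j), \<infinity>)) [0..<n] = qs"
      by (intro nth_equalityI) (auto simp: n_def)
    then have 2: "image_mset (\<lambda>j. (x (2 * m + j), \<infinity>)) (mset_set {..<n}) =
                  filter_mset (\<lambda>p. \<not> snd p \<noteq> \<infinity>) M"
      using list[of "\<lambda>j. (x (2 * m + j), \<infinity>)" n] by (simp only: qs)
    have "Qmap m n x = D"
      unfolding Qmap_def M(1) 1 2 by (simp only: multiset_partition[symmetric])
    moreover have "((m, n), x) \<in> OrdBar"
      by (simp add: OrdBar_def topspace_Euclidean_space x_def)
    ultimately show "D \<in> quotient_map_Bar ` OrdBar"
      by (force simp: quotient_map_Bar_def)
  qed
qed

lemma Bar_diffeology_finest:
  defines "\<Phi> \<equiv> \<lambda>D. quotient_map_Bar \<in> smooth_maps OrdBar sum_diffeology Bar D"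
  shows "diffeology Bar Bar_diffeology" and "\<Phi> Bar_diffeology"
    and "\<And>D. diffeology Bar D \<Longrightarrow> \<Phi> D \<Longrightarrow> Bar_diffeology \<subseteq> D"
proof -
  have "barcode_of_mset {#} \<in> Bar" unfolding Bar_def by force
  then have coarse: "diffeology Bar (parametrizations Bar)"
    by (intro diffeology_coarse) blast
  have "quotient_map_Bar \<in> OrdBar \<rightarrow>\<^sub>E Bar"
  proof (rule PiE_I)
    show "quotient_map_Bar z \<in> Bar" if "z \<in> OrdBar" for z
      using that quotient_map_Bar_onto by blast
    show "quotient_map_Bar z = undefined" if "z \<notin> OrdBar" for z
      using that by (simp add: quotient_map_Bar_def)
  qed
  moreover have "sum_diffeology \<subseteq> parametrizations OrdBar"
    by (rule diffeologyD(2)[OF sum_diffeology_finest(1)])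
  ultimately have "\<Phi> (parametrizations Bar)"
    unfolding \<Phi>_def by (rule smooth_maps_coarse)
  with coarse have ne: "{D. diffeology Bar D \<and> \<Phi> D} \<noteq> {}" by blast
  show "diffeology Bar Bar_diffeology"
    unfolding Bar_diffeology_def finest_diffeology_def \<Phi>_def[symmetric]
    by (rule diffeology_Inter[OF ne]) blast
  show "\<Phi> Bar_diffeology"
    unfolding Bar_diffeology_def finest_diffeology_def \<Phi>_def[symmetric]
    unfolding \<Phi>_def by (intro smooth_maps_Inter ne[unfolded \<Phi>_def]) blast
  show "\<And>D. diffeology Bar D \<Longrightarrow> \<Phi> D \<Longrightarrow> Bar_diffeology \<subseteq> D"
    unfolding Bar_diffeology_def finest_diffeology_def \<Phi>_def[symmetric] by blast
qed

end

theory Submission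
  imports Defs
begin

text \<open>Both sides say of a map \<open>V\<close> that \<open>V \<circ> Qmap m n\<close> is smooth on all of \<open>Rn (2 * m + n)\<close>, for all
  \<open>m\<close> and \<open>n\<close>.

  For differentiability at all barcodes this is gluing: every point of \<open>Rn (2 * m + n)\<close> lies over
  some barcode, so each point has a neighbourhood on which \<open>V \<circ> Qmap m n\<close> is smooth, and smoothness
  is local (\<open>infinitely_differentiable_iff\<close>).

  For diffeological smoothness it is the universal property of the two finest diffeologies
  (\<open>smooth_maps_from_Bar_iff\<close>). Parametrizations whose composite with a fixed map is a plot of the
  target form a diffeology (\<open>diffeology_pullback\<close>). Hence the pullback along \<open>V\<close> contains all plots of
  \<open>Bar\<close> as soon as its own pullback along the quotient map contains all plots of the sum, and the
  latter holds as soon as it contains the images of the Euclidean plots under the inclusions. This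
  asks that \<open>V \<circ> Qmap m n \<circ> P\<close> be a plot for every Euclidean plot \<open>P\<close>, and as plots are stable under
  smooth reparametrization, the single case of the identity \<open>P\<close> suffices.

  The argument applies to a target \<open>\<N>\<close> once its smooth parametrizations are known to form a
  diffeology (\<open>diffeology_manifold\<close>), and the one axiom with analytic content is stability under smooth
  reparametrization. It amounts to the statement that composites of \<open>C^r\<close> maps between domains are
  \<open>C^r\<close> (\<open>Ck_on_compose\<close>). As \<open>C^r\<close> is phrased by iterated partial derivatives, a chain rule for
  functions with continuous partial derivatives is needed first
  (\<open>has_real_derivative_along_curve\<close>).\<close>

section \<open>Open sets and continuity in Euclidean space\<close>

text \<open>The topology of \<open>Euclidean_space k\<close> is that of a subspace of a countable product. Since only the
  first \<open>k\<close> coordinates can vary, cubes are a neighbourhood base, which brings openness into the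
  form needed for estimates.\<close>

lemma openin_Euclidean_space_box:
  assumes U: "openin (Euclidean_space k) U" and a: "a \<in> U"
  obtains e where "e > 0" "\<And>p. p \<in> Rn k \<Longrightarrow> (\<And>i. i < k \<Longrightarrow> \<bar>p i - a i\<bar> < e) \<Longrightarrow> p \<in> U"
proof -
  obtain T where T: "openin (powertop_real UNIV) T" "U = T \<inter> {x. \<forall>i\<ge>k. x i = 0}"
    using U by (auto simp: Euclidean_space_def openin_subtopology)
  obtain X where X: "a \<in> (\<Pi>\<^sub>E i\<in>UNIV. X i)" "\<And>i. open (X i)" "(\<Pi>\<^sub>E i\<in>UNIV. X i) \<subseteq> T"
    using product_topology_open_contains_basis[OF T(1), of a] a T(2) by auto
  have "\<exists>e>0. \<forall>y. \<bar>y - a i\<bar> < e \<longrightarrow> y \<in> X i" for i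
  proof -
    have "a i \<in> X i" using X(1) by blast
    with X(2)[of i] show ?thesis unfolding open_dist dist_real_def by blast
  qed
  then obtain e where e: "\<And>i. e i > 0" "\<And>i y. \<bar>y - a i\<bar> < e i \<Longrightarrow> y \<in> X i"
    by metis
  show ?thesis
  proof
    show "Min (insert 1 (e ` {..<k})) > 0"
      using e(1) by (subst Min_gr_iff) auto
    fix p assume p: "p \<in> Rn k" "\<And>i. i < k \<Longrightarrow> \<bar>p i - a i\<bar> < Min (insert 1 (e ` {..<k}))"
    have "p i \<in> X i" for i
    proof (cases "i < k")
      case True
      have "\<bar>p i - a i\<bar> < e i"
        by (rule less_le_trans[OF p(2)[OF True]]) (use True in \<open>auto intro!: Min_le\<close>)
      then show ?thesis by (rule e(2))
    next
      case False
      then have "p i = a i"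
        using p(1) a T(2) by (simp add: topspace_Euclidean_space)
      then show ?thesis using X(1) by auto
    qed
    then show "p \<in> U"
      using X(3) T(2) p(1) by (auto simp: topspace_Euclidean_space)
  qed
qed

text \<open>A partial derivative at a point of a domain only sees points of that domain.\<close>

lemma eventually_coordinate_update_in:
  assumes U: "openin (Euclidean_space k) U" and x: "x \<in> U" and i: "i < k"
  shows "eventually (\<lambda>t. x(i := t) \<in> U) (nhds (x i))"
proof -
  obtain e where e: "e > 0" "\<And>p. p \<in> Rn k \<Longrightarrow> (\<And>j. j < k \<Longrightarrow> \<bar>p j - x j\<bar> < e) \<Longrightarrow> p \<in> U"
    using openin_Euclidean_space_box[OF U x] by blast
  have xRn: "x \<in> Rn k" using openin_subset[OF U] x by blast
  have "x(i := t) \<in> U" if "dist t (x i) < e" for t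
  proof (rule e(2))
    show "x(i := t) \<in> Rn k" using xRn i by (simp add: topspace_Euclidean_space)
    show "\<bar>(x(i := t)) j - x j\<bar> < e" for j
      using that e(1) by (simp add: dist_real_def)
  qed
  with e(1) show ?thesis unfolding eventually_nhds_metric by blast
qed

lemma continuous_map_into_Euclidean_subspace:
  assumes F: "F \<in> topspace X \<rightarrow> U" and U: "U \<subseteq> Rn k"
    and cont: "\<And>j. j < k \<Longrightarrow> continuous_map X euclideanreal (\<lambda>x. F x j)"
  shows "continuous_map X (subtopology (Euclidean_space k) U) F"
proof -
  have FRn: "F x \<in> Rn k" if "x \<in> topspace X" for x
    using F U that by blast
  have "continuous_map X euclideanreal (\<lambda>x. F x j)" for j
  proof (cases "j < k")
    case False
    then have "0 = F x j" if "x \<in> topspace X" for x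
      using FRn[OF that] by (simp add: topspace_Euclidean_space)
    then show ?thesis by (intro continuous_map_eq[where f = "\<lambda>_. 0" and g = "\<lambda>x. F x j"]) simp_all
  qed (rule cont)
  then have "continuous_map X (powertop_real UNIV) F"
    by (simp add: continuous_map_componentwise_UNIV)
  then have "continuous_map X (Euclidean_space k) F"
    using FRn unfolding Euclidean_space_def continuous_map_in_subtopology
    by (auto simp: topspace_Euclidean_space[unfolded Euclidean_space_def])
  with F show ?thesis
    by (auto simp: continuous_map_in_subtopology)
qed

lemma topspace_subtopology_open:
  "openin (Euclidean_space k) U \<Longrightarrow> topspace (subtopology (Euclidean_space k) U) = U"
  by (rule topspace_subtopology_subset[OF openin_subset])


section \<open>Calculus of functions of class $C^r$\<close>

lemma partial_deriv_cong:
  assumes U: "openin (Euclidean_space k) U" and x: "x \<in> U" and i: "i < k"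
    and eq: "\<And>y. y \<in> U \<Longrightarrow> f y = g y"
  shows "partial_deriv i f x = partial_deriv i g x"
    and "(\<lambda>t. f (x(i := t))) differentiable (at (x i)) \<longleftrightarrow>
         (\<lambda>t. g (x(i := t))) differentiable (at (x i))"
proof -
  have ev: "eventually (\<lambda>t. f (x(i := t)) = g (x(i := t))) (nhds (x i))"
    using eventually_coordinate_update_in[OF U x i] by eventually_elim (rule eq)
  show "partial_deriv i f x = partial_deriv i g x"
    unfolding partial_deriv_def by (rule deriv_cong_ev[OF ev refl])
  show "(\<lambda>t. f (x(i := t))) differentiable (at (x i)) \<longleftrightarrow>
         (\<lambda>t. g (x(i := t))) differentiable (at (x i))"
    unfolding real_differentiable_def using DERIV_cong_ev[OF refl ev refl] by simp
qed

text \<open>Functions are total, but values outside the domain do not influence any partial derivative inside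
  it. This makes smoothness a property of the restricted map, so that \<open>compose U V P\<close> and
  \<open>V \<circ> P\<close> may be exchanged later.\<close>

lemma Ck_on_cong:
  assumes U: "openin (Euclidean_space k) U" and eq: "\<And>y. y \<in> U \<Longrightarrow> f y = g y"
  shows "Ck_on r k U f \<longleftrightarrow> Ck_on r k U g"
  using eq
proof (induction r arbitrary: f g)
  case 0
  then show ?case
    using continuous_map_eq[of "subtopology (Euclidean_space k) U" euclideanreal]
    by (auto simp: topspace_subtopology_open[OF U])
next
  case (Suc r)
  have "continuous_map (subtopology (Euclidean_space k) U) euclideanreal f \<longleftrightarrow>
        continuous_map (subtopology (Euclidean_space k) U) euclideanreal g"
    using continuous_map_eq[of "subtopology (Euclidean_space k) U" euclideanreal] Suc.prems
    by (auto simp: topspace_subtopology_open[OF U])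
  moreover have "Ck_on r k U (partial_deriv i f) \<longleftrightarrow> Ck_on r k U (partial_deriv i g)" if "i < k" for i
    by (rule Suc.IH) (rule partial_deriv_cong(1)[OF U _ that Suc.prems])
  moreover have "(\<lambda>t. f (x(i := t))) differentiable (at (x i)) \<longleftrightarrow>
        (\<lambda>t. g (x(i := t))) differentiable (at (x i))" if "x \<in> U" "i < k" for x i
    by (rule partial_deriv_cong(2)[OF U that Suc.prems])
  ultimately show ?case by simp
qed

lemma Ck_on_continuous:
  "Ck_on r k U f \<Longrightarrow> continuous_map (subtopology (Euclidean_space k) U) euclideanreal f"
  by (cases r) simp_all

lemma Ck_on_SucD: "Ck_on (Suc r) k U f \<Longrightarrow> Ck_on r k U f"
proof (induction r arbitrary: f)
  case (Suc r)
  have "Ck_on r k U (partial_deriv i f)" if "i < k" for i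
    by (rule Suc.IH) (use Suc.prems that in \<open>simp only: Ck_on.simps(2)[of "Suc r"]\<close>)
  with Suc.prems show ?case
    unfolding Ck_on.simps(2)[of "Suc r"] Ck_on.simps(2)[of r k U f] by blast
qed simp

lemma Ck_on_mono:
  assumes "Ck_on r k U f" "q \<le> r"
  shows "Ck_on q k U f"
  using assms(2,1)
proof (induction r rule: dec_induct)
  case (step n)
  show ?case by (rule step.IH[OF Ck_on_SucD[OF step.prems]])
qed

lemma Ck_on_subset:
  assumes "Ck_on r k U f" "U' \<subseteq> U"
  shows "Ck_on r k U' f"
  using assms(1)
proof (induction r arbitrary: f)
  case 0
  then show ?case
    using continuous_map_from_subtopology_mono[OF _ assms(2)] by auto
next
  case (Suc r)
  then show ?case
    using continuous_map_from_subtopology_mono[OF _ assms(2)] assms(2) by auto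
qed

text \<open>The form in which partial derivatives are produced below: by exhibiting them, which settles
  their existence and, through uniqueness, the value of \<open>partial_deriv\<close>.\<close>

lemma Ck_on_SucI:
  assumes U: "openin (Euclidean_space k) U"
    and cont: "continuous_map (subtopology (Euclidean_space k) U) euclideanreal f"
    and der: "\<And>i x. i < k \<Longrightarrow> x \<in> U \<Longrightarrow>
                ((\<lambda>t. f (x(i := t))) has_real_derivative D i x) (at (x i))"
    and D: "\<And>i. i < k \<Longrightarrow> Ck_on r k U (D i)"
  shows "Ck_on (Suc r) k U f"
proof -
  have "Ck_on r k U (partial_deriv i f)" if i: "i < k" for i
    using Ck_on_cong[OF U, of "partial_deriv i f" "D i" r] D[OF i] der[OF i]
    by (simp add: partial_deriv_def DERIV_imp_deriv)
  with cont der show ?thesis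
    unfolding Ck_on.simps real_differentiable_def by blast
qed

lemma Ck_on_Suc_partial:
  assumes "Ck_on (Suc r) k U f" "i < k"
  shows "x \<in> U \<Longrightarrow> ((\<lambda>t. f (x(i := t))) has_real_derivative partial_deriv i f x) (at (x i))"
    and "Ck_on r k U (partial_deriv i f)"
  using assms by (simp_all add: partial_deriv_def DERIV_deriv_iff_real_differentiable)

lemma Ck_on_const:
  assumes "openin (Euclidean_space k) U"
  shows "Ck_on r k U (\<lambda>_. c)"
proof (induction r arbitrary: c)
  case (Suc r)
  show ?case
    by (rule Ck_on_SucI[OF assms, where D = "\<lambda>_ _. 0"]) (auto intro: Suc.IH)
qed simp

lemma Ck_on_coordinate:
  assumes U: "openin (Euclidean_space k) U"
  shows "Ck_on r k U (\<lambda>x. x j)"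
proof -
  have cont: "continuous_map (subtopology (Euclidean_space k) U) euclideanreal (\<lambda>x. x j)"
    unfolding Euclidean_space_def
    by (intro continuous_map_from_subtopology continuous_map_product_projection) simp
  show ?thesis
  proof (cases r)
    case (Suc r')
    have "((\<lambda>t. (x(i := t)) j) has_real_derivative (if i = j then 1 else 0)) (at (x i))"
      for i and x :: "nat \<Rightarrow> real"
      by (cases "i = j") (auto intro: DERIV_ident)
    then show ?thesis
      unfolding Suc by (rule Ck_on_SucI[OF U cont]) (rule Ck_on_const[OF U])
  qed (use cont in simp)
qed

lemma Ck_on_add:
  assumes U: "openin (Euclidean_space k) U"
  shows "Ck_on r k U f \<Longrightarrow> Ck_on r k U g \<Longrightarrow> Ck_on r k U (\<lambda>x. f x + g x)"
proof (induction r arbitrary: f g)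
  case 0
  then show ?case by (auto intro: continuous_map_add)
next
  case (Suc r)
  show ?case
  proof (rule Ck_on_SucI[OF U])
    show "continuous_map (subtopology (Euclidean_space k) U) euclideanreal (\<lambda>x. f x + g x)"
      using Suc.prems by (intro continuous_map_add Ck_on_continuous)
    fix i x assume "i < k" "x \<in> U"
    from Ck_on_Suc_partial(1)[OF Suc.prems(1) this] Ck_on_Suc_partial(1)[OF Suc.prems(2) this]
    show "((\<lambda>t. f (x(i := t)) + g (x(i := t))) has_real_derivative
            partial_deriv i f x + partial_deriv i g x) (at (x i))"
      by (rule DERIV_add)
  next
    fix i assume "i < k"
    with Suc.prems show "Ck_on r k U (\<lambda>x. partial_deriv i f x + partial_deriv i g x)"
      by (intro Suc.IH Ck_on_Suc_partial(2))
  qed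
qed

lemma Ck_on_mult:
  assumes U: "openin (Euclidean_space k) U"
  shows "Ck_on r k U f \<Longrightarrow> Ck_on r k U g \<Longrightarrow> Ck_on r k U (\<lambda>x. f x * g x)"
proof (induction r arbitrary: f g)
  case 0
  then show ?case by (auto intro: continuous_map_real_mult)
next
  case (Suc r)
  show ?case
  proof (rule Ck_on_SucI[OF U])
    show "continuous_map (subtopology (Euclidean_space k) U) euclideanreal (\<lambda>x. f x * g x)"
      using Suc.prems by (intro continuous_map_real_mult Ck_on_continuous)
    fix i x assume "i < k" "x \<in> U"
    from DERIV_mult[OF Ck_on_Suc_partial(1)[OF Suc.prems(1) this]
        Ck_on_Suc_partial(1)[OF Suc.prems(2) this], unfolded fun_upd_triv]
    show "((\<lambda>t. f (x(i := t)) * g (x(i := t))) has_real_derivative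
            partial_deriv i f x * g x + partial_deriv i g x * f x) (at (x i))" .
  next
    fix i assume i: "i < k"
    show "Ck_on r k U (\<lambda>x. partial_deriv i f x * g x + partial_deriv i g x * f x)"
      by (intro Ck_on_add[OF U] Suc.IH Ck_on_Suc_partial(2)[OF _ i]
          Suc.prems Suc.prems[THEN Ck_on_SucD])
  qed
qed

lemma Ck_on_sum:
  assumes U: "openin (Euclidean_space k) U" and f: "\<And>j. j \<in> J \<Longrightarrow> Ck_on r k U (f j)"
  shows "Ck_on r k U (\<lambda>x. \<Sum>j\<in>J. f j x)"
  using f
proof (induction J rule: infinite_finite_induct)
  case (insert j J)
  then show ?case by (simp add: Ck_on_add[OF U])
qed (simp_all add: Ck_on_const[OF U])


section \<open>The chain rule\<close>

text \<open>Changing one coordinate near \<open>a\<close> changes \<open>f\<close>, by the mean value theorem, by a value of the partial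
  derivative at a nearby point, and continuity makes that value close to the one at \<open>a\<close>. The
  estimate is uniform in the base point \<open>p\<close>, which is what the telescoping in \<open>total_differential\<close>
  requires.\<close>

lemma partial_increment:
  assumes f: "Ck_on (Suc 0) k U f" and U: "openin (Euclidean_space k) U"
    and a: "a \<in> U" and j: "j < k" and \<epsilon>: "\<epsilon> > 0"
  obtains e where "e > 0"
    "\<And>p s. p \<in> Rn k \<Longrightarrow> (\<And>i. i < k \<Longrightarrow> \<bar>p i - a i\<bar> < e) \<Longrightarrow> \<bar>s - a j\<bar> < e \<Longrightarrow>
       \<bar>f (p(j := s)) - f p - partial_deriv j f a * (s - p j)\<bar> \<le> \<epsilon> * \<bar>s - p j\<bar>"
proof -
  let ?f' = "partial_deriv j f"
  \<comment> \<open>The set where the partial derivative is within \<open>\<epsilon>\<close> of its value at \<open>a\<close>; it contains a cube,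
    and with the two ends of a segment parallel to an axis the cube contains the segment.\<close>
  define V where "V = {x \<in> U. ?f' x \<in> ball (?f' a) \<epsilon>}"
  have "continuous_map (subtopology (Euclidean_space k) U) euclideanreal ?f'"
    using f j by auto
  from openin_continuous_map_preimage[OF this, of "ball (?f' a) \<epsilon>"]
  have "openin (subtopology (Euclidean_space k) U) V"
    unfolding V_def topspace_subtopology_open[OF U] by simp
  then have "openin (Euclidean_space k) V"
    using U by (rule openin_trans_full)
  moreover have "a \<in> V" using a \<epsilon> by (simp add: V_def)
  ultimately obtain e where e: "e > 0"
    "\<And>p. p \<in> Rn k \<Longrightarrow> (\<And>i. i < k \<Longrightarrow> \<bar>p i - a i\<bar> < e) \<Longrightarrow> p \<in> V"
    using openin_Euclidean_space_box by metis
  show ?thesis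
  proof (rule that[OF e(1)])
    fix p s assume p: "p \<in> Rn k" "\<And>i. i < k \<Longrightarrow> \<bar>p i - a i\<bar> < e" and s: "\<bar>s - a j\<bar> < e"
    have in_V: "p(j := t) \<in> V" if "min s (p j) \<le> t" "t \<le> max s (p j)" for t
    proof (rule e(2))
      show "p(j := t) \<in> Rn k" using p(1) j by (auto simp: topspace_Euclidean_space)
      show "\<bar>(p(j := t)) i - a i\<bar> < e" if "i < k" for i
        using \<open>min s (p j) \<le> t\<close> \<open>t \<le> max s (p j)\<close> p(2)[OF that] p(2)[OF j] s
        by (auto simp: min_def max_def split: if_splits)
    qed
    have der: "((\<lambda>t. f (p(j := t))) has_real_derivative ?f' (p(j := t))) (at t)"
      if "min s (p j) \<le> t" "t \<le> max s (p j)" for t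
      using Ck_on_Suc_partial(1)[OF f j, of "p(j := t)"] in_V[OF that] by (simp add: V_def)
    show "\<bar>f (p(j := s)) - f p - ?f' a * (s - p j)\<bar> \<le> \<epsilon> * \<bar>s - p j\<bar>"
    proof (cases "s = p j")
      case False
      have "\<exists>z. min s (p j) < z \<and> z < max s (p j) \<and>
              f (p(j := max s (p j))) - f (p(j := min s (p j))) =
              (max s (p j) - min s (p j)) * ?f' (p(j := z))"
        using False by (intro MVT2 der) auto
      then obtain z where z: "min s (p j) < z" "z < max s (p j)"
        and eq: "f (p(j := max s (p j))) - f (p(j := min s (p j))) =
                 (max s (p j) - min s (p j)) * ?f' (p(j := z))" by blast
      have "f (p(j := s)) - f p = ?f' (p(j := z)) * (s - p j)"
        using eq by (auto simp: min_def max_def algebra_simps split: if_splits)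
      then have "\<bar>f (p(j := s)) - f p - ?f' a * (s - p j)\<bar> = \<bar>?f' (p(j := z)) - ?f' a\<bar> * \<bar>s - p j\<bar>"
        by (simp add: left_diff_distrib abs_mult[symmetric])
      moreover have "\<bar>?f' (p(j := z)) - ?f' a\<bar> \<le> \<epsilon>"
        using in_V[of z] z by (auto simp: V_def dist_real_def)
      ultimately show ?thesis by (simp add: mult_right_mono)
    qed simp
  qed
qed

text \<open>Continuous partial derivatives give a total differential: walk from \<open>a\<close> to \<open>p\<close> one coordinate at a
  time and add up the increments.\<close>

lemma total_differential:
  assumes f: "Ck_on (Suc 0) k U f" and U: "openin (Euclidean_space k) U"
    and a: "a \<in> U" and \<epsilon>: "\<epsilon> > 0"
  obtains e where "e > 0"
    "\<And>p. p \<in> Rn k \<Longrightarrow> (\<And>i. i < k \<Longrightarrow> \<bar>p i - a i\<bar> < e) \<Longrightarrow>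
       \<bar>f p - f a - (\<Sum>j<k. partial_deriv j f a * (p j - a j))\<bar> \<le> \<epsilon> * (\<Sum>j<k. \<bar>p j - a j\<bar>)"
proof -
  have "\<forall>j\<in>{..<k}. \<exists>e>0. \<forall>p s. p \<in> Rn k \<longrightarrow> (\<forall>i<k. \<bar>p i - a i\<bar> < e) \<longrightarrow> \<bar>s - a j\<bar> < e \<longrightarrow>
       \<bar>f (p(j := s)) - f p - partial_deriv j f a * (s - p j)\<bar> \<le> \<epsilon> * \<bar>s - p j\<bar>"
    using partial_increment[OF f U a _ \<epsilon>] by (metis lessThan_iff)
  then obtain \<delta> where \<delta>: "\<And>j. j < k \<Longrightarrow> \<delta> j > 0"
    "\<And>j p s. j < k \<Longrightarrow> p \<in> Rn k \<Longrightarrow> (\<And>i. i < k \<Longrightarrow> \<bar>p i - a i\<bar> < \<delta> j) \<Longrightarrow> \<bar>s - a j\<bar> < \<delta> j \<Longrightarrow>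
       \<bar>f (p(j := s)) - f p - partial_deriv j f a * (s - p j)\<bar> \<le> \<epsilon> * \<bar>s - p j\<bar>"
    by (metis lessThan_iff)
  define e where "e = Min (insert 1 (\<delta> ` {..<k}))"
  have e_le: "e \<le> \<delta> j" if "j < k" for j
    using that unfolding e_def by (intro Min_le) auto
  have aRn: "a \<in> Rn k" using openin_subset[OF U] a by blast
  show ?thesis
  proof
    show e0: "e > 0" unfolding e_def using \<delta>(1) by (subst Min_gr_iff) auto
    fix p assume p: "p \<in> Rn k" "\<And>i. i < k \<Longrightarrow> \<bar>p i - a i\<bar> < e"
    \<comment> \<open>The corners of the walk from \<open>a\<close> to \<open>p\<close>; all of them stay in the cube around \<open>a\<close>.\<close>
    define h where "h j = (\<lambda>i. if i < j then p i else a i)" for j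
    have h0: "h 0 = a" and hk: "h k = p"
      using p(1) aRn by (auto simp: h_def topspace_Euclidean_space fun_eq_iff)
    have step: "\<bar>f (h (Suc j)) - f (h j) - partial_deriv j f a * (p j - a j)\<bar> \<le> \<epsilon> * \<bar>p j - a j\<bar>"
      if j: "j < k" for j
    proof -
      have "h (Suc j) = (h j)(j := p j)" "h j j = a j" by (auto simp: h_def)
      moreover have "h j \<in> Rn k"
        using p(1) aRn by (auto simp: h_def topspace_Euclidean_space)
      moreover have "\<bar>h j i - a i\<bar> < \<delta> j" if "i < k" for i
        using p(2)[OF that] e_le[OF j] e0 \<delta>(1)[OF j] by (auto simp: h_def)
      moreover have "\<bar>p j - a j\<bar> < \<delta> j" using p(2)[OF j] e_le[OF j] by simp
      ultimately show ?thesis using \<delta>(2)[OF j, of "h j" "p j"] by simp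
    qed
    have "f p - f a - (\<Sum>j<k. partial_deriv j f a * (p j - a j)) =
          (\<Sum>j<k. f (h (Suc j)) - f (h j) - partial_deriv j f a * (p j - a j))"
      using sum_lessThan_telescope[of "\<lambda>j. f (h j)" k] by (simp add: sum_subtractf h0 hk)
    also have "\<bar>\<dots>\<bar> \<le> (\<Sum>j<k. \<bar>f (h (Suc j)) - f (h j) - partial_deriv j f a * (p j - a j)\<bar>)"
      by (rule sum_abs)
    also have "\<dots> \<le> (\<Sum>j<k. \<epsilon> * \<bar>p j - a j\<bar>)"
      by (intro sum_mono step) simp
    finally show "\<bar>f p - f a - (\<Sum>j<k. partial_deriv j f a * (p j - a j))\<bar> \<le>
                  \<epsilon> * (\<Sum>j<k. \<bar>p j - a j\<bar>)"
      by (simp add: sum_distrib_left)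
  qed
qed

text \<open>The chain rule. The linear part of the total differential contributes the sum; the remainder,
  divided by \<open>t - t0\<close>, is at most an arbitrarily small multiple of the difference quotients of
  \<open>g\<close>, which stay bounded.\<close>

lemma has_real_derivative_along_curve:
  assumes f: "Ck_on (Suc 0) k U f" and U: "openin (Euclidean_space k) U"
    and g: "g t0 \<in> U" "\<forall>\<^sub>F t in nhds t0. g t \<in> Rn k"
    and g': "\<And>j. j < k \<Longrightarrow> ((\<lambda>t. g t j) has_real_derivative g' j) (at t0)"
  shows "((\<lambda>t. f (g t)) has_real_derivative (\<Sum>j<k. partial_deriv j f (g t0) * g' j)) (at t0)"
proof -
  let ?q = "\<lambda>j t. (g t j - g t0 j) / (t - t0)"
  let ?L = "\<lambda>p. \<Sum>j<k. partial_deriv j f (g t0) * p j"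
  define r where "r t = f (g t) - f (g t0) - ?L (\<lambda>j. g t j - g t0 j)" for t
  have q: "(?q j \<longlongrightarrow> g' j) (at t0)" if "j < k" for j
    using g'[OF that] by (simp add: has_field_derivative_iff)
  have "((\<lambda>t. r t / (t - t0)) \<longlongrightarrow> 0) (at t0)"
  proof (rule tendstoI)
    fix \<eta> :: real assume \<eta>: "\<eta> > 0"
    \<comment> \<open>An eventual bound for the sum of the absolute difference quotients of \<open>g\<close>; the added 1
      makes it strict and positive.\<close>
    define M where "M = (\<Sum>j<k. \<bar>g' j\<bar>) + 1"
    have M: "M > 0" unfolding M_def by (simp add: sum_nonneg add_nonneg_pos)
    have \<epsilon>: "\<eta> / M > 0" using \<eta> M by simp
    obtain e where e: "e > 0" "\<And>p. p \<in> Rn k \<Longrightarrow> (\<And>i. i < k \<Longrightarrow> \<bar>p i - g t0 i\<bar> < e) \<Longrightarrow>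
       \<bar>f p - f (g t0) - ?L (\<lambda>j. p j - g t0 j)\<bar> \<le> \<eta> / M * (\<Sum>j<k. \<bar>p j - g t0 j\<bar>)"
      using total_differential[OF f U g(1) \<epsilon>] by blast
    have "\<forall>\<^sub>F t in at t0. \<forall>j\<in>{..<k}. \<bar>g t j - g t0 j\<bar> < e"
    proof (rule eventually_ball_finite)
      show "\<forall>j\<in>{..<k}. \<forall>\<^sub>F t in at t0. \<bar>g t j - g t0 j\<bar> < e"
      proof
        fix j assume "j \<in> {..<k}"
        then have "((\<lambda>t. g t j) \<longlongrightarrow> g t0 j) (at t0)"
          using DERIV_isCont[OF g'] by (simp add: isCont_def)
        from tendstoD[OF this e(1)] show "\<forall>\<^sub>F t in at t0. \<bar>g t j - g t0 j\<bar> < e"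
          by (simp add: dist_real_def)
      qed
    qed simp
    moreover have "\<forall>\<^sub>F t in at t0. (\<Sum>j<k. \<bar>?q j t\<bar>) < M"
    proof (rule order_tendstoD(2))
      show "((\<lambda>t. \<Sum>j<k. \<bar>?q j t\<bar>) \<longlongrightarrow> (\<Sum>j<k. \<bar>g' j\<bar>)) (at t0)"
        by (intro tendsto_sum tendsto_rabs q) simp
    qed (simp add: M_def)
    moreover have "\<forall>\<^sub>F t in at t0. g t \<in> Rn k"
      using g(2) by (simp add: eventually_at_filter eventually_mono)
    moreover have "\<forall>\<^sub>F t in at t0. t \<noteq> t0" by (rule eventually_neq_at_within)
    ultimately show "\<forall>\<^sub>F t in at t0. dist (r t / (t - t0)) 0 < \<eta>"
    proof eventually_elim
      case (elim t)
      have "\<bar>r t\<bar> \<le> \<eta> / M * (\<Sum>j<k. \<bar>g t j - g t0 j\<bar>)"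
        unfolding r_def using elim by (intro e(2)) auto
      then have "\<bar>r t / (t - t0)\<bar> \<le> \<eta> / M * (\<Sum>j<k. \<bar>g t j - g t0 j\<bar>) / \<bar>t - t0\<bar>"
        unfolding abs_divide by (rule divide_right_mono) simp
      also have "\<dots> = \<eta> / M * (\<Sum>j<k. \<bar>?q j t\<bar>)"
        by (simp add: sum_divide_distrib sum_distrib_left)
      also have "\<dots> < \<eta> / M * M"
        using elim \<epsilon> by (intro mult_strict_left_mono) auto
      finally show ?case using M by (simp add: dist_real_def)
    qed
  qed
  moreover have "((\<lambda>t. ?L (\<lambda>j. ?q j t)) \<longlongrightarrow> ?L g') (at t0)"
    by (intro tendsto_sum tendsto_mult tendsto_const q) simp
  ultimately have "((\<lambda>t. r t / (t - t0) + ?L (\<lambda>j. ?q j t)) \<longlongrightarrow> 0 + ?L g') (at t0)"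
    by (rule tendsto_add)
  moreover have "r t / (t - t0) + ?L (\<lambda>j. ?q j t) = (f (g t) - f (g t0)) / (t - t0)" for t
    by (simp add: r_def diff_divide_distrib sum_divide_distrib flip: times_divide_eq_right)
  ultimately show ?thesis
    by (simp add: has_field_derivative_iff)
qed

text \<open>Induction on \<open>r\<close>: by the chain rule the partial derivatives of the composite are sums of products
  of \<open>partial_deriv j f \<circ> F\<close>, to which the induction hypothesis applies because \<open>f\<close> is
  generalized, with partial derivatives of the components of \<open>F\<close>.\<close>

lemma Ck_on_compose:
  assumes U: "openin (Euclidean_space k) U" and W: "openin (Euclidean_space l) W"
    and FU: "F ` W \<subseteq> U" and F: "\<And>j. j < k \<Longrightarrow> Ck_on r l W (\<lambda>x. F x j)"
    and f: "Ck_on r k U f"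
  shows "Ck_on r l W (\<lambda>x. f (F x))"
  using F f
proof (induction r arbitrary: f)
  case (0 f)
  have "continuous_map (subtopology (Euclidean_space l) W) (subtopology (Euclidean_space k) U) F"
    using 0 FU openin_subset[OF U]
    by (intro continuous_map_into_Euclidean_subspace) (auto simp: topspace_subtopology_open[OF W])
  with 0 show ?case
    using continuous_map_compose[of _ _ F euclideanreal f] by (simp add: o_def)
next
  case (Suc r f)
  have f1: "Ck_on (Suc 0) k U f"
    by (rule Ck_on_mono[OF Suc.prems(2)]) simp
  show ?case
  proof (rule Ck_on_SucI[OF W])
    show "continuous_map (subtopology (Euclidean_space l) W) euclideanreal (\<lambda>x. f (F x))"
      by (rule Ck_on_continuous[OF Suc.IH[OF Ck_on_SucD[OF Suc.prems(1)] Ck_on_SucD[OF Suc.prems(2)]]])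
    fix i x assume i: "i < l" and x: "x \<in> W"
    have "\<forall>\<^sub>F t in nhds (x i). F (x(i := t)) \<in> Rn k"
      using eventually_coordinate_update_in[OF W x i]
      by eventually_elim (use FU openin_subset[OF U] in blast)
    moreover have "F (x(i := x i)) \<in> U" using FU x by auto
    moreover have "((\<lambda>t. F (x(i := t)) j) has_real_derivative partial_deriv i (\<lambda>x. F x j) x) (at (x i))"
      if "j < k" for j
      by (rule Ck_on_Suc_partial(1)[OF Suc.prems(1)[OF that] i x])
    ultimately show "((\<lambda>t. f (F (x(i := t)))) has_real_derivative
        (\<Sum>j<k. partial_deriv j f (F x) * partial_deriv i (\<lambda>x. F x j) x)) (at (x i))"
      using has_real_derivative_along_curve[OF f1 U, where g = "\<lambda>t. F (x(i := t))" and ?t0.0 = "x i"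
          and g' = "\<lambda>j. partial_deriv i (\<lambda>x. F x j) x"]
      by (simp only: fun_upd_triv)
  next
    fix i assume i: "i < l"
    have "Ck_on r l W (\<lambda>x. partial_deriv j f (F x) * partial_deriv i (\<lambda>x. F x j) x)"
      if "j \<in> {..<k}" for j
    proof -
      from that have j: "j < k" by simp
      show ?thesis
        by (rule Ck_on_mult[OF W Suc.IH[OF Ck_on_SucD[OF Suc.prems(1)]
              Ck_on_Suc_partial(2)[OF Suc.prems(2) j]] Ck_on_Suc_partial(2)[OF Suc.prems(1)[OF j] i]])
    qed
    then show "Ck_on r l W (\<lambda>x. \<Sum>j<k. partial_deriv j f (F x) * partial_deriv i (\<lambda>x. F x j) x)"
      by (rule Ck_on_sum[OF W])
  qed
qed


section \<open>Smooth maps between domains and into manifolds\<close>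

lemma smooth_on_cong:
  assumes "openin (Euclidean_space k) U" "\<And>y. y \<in> U \<Longrightarrow> F y = G y"
  shows "smooth_on k U l F \<longleftrightarrow> smooth_on k U l G"
proof -
  have "Ck_on r k U (\<lambda>x. F x j) \<longleftrightarrow> Ck_on r k U (\<lambda>x. G x j)" for r j
    by (rule Ck_on_cong[OF assms(1)]) (simp add: assms(2))
  moreover have "F ` U = G ` U" using assms(2) by (rule image_cong[OF refl])
  ultimately show ?thesis by (simp add: smooth_on_def)
qed

lemma smooth_on_const:
  "openin (Euclidean_space k) U \<Longrightarrow> c \<in> Rn l \<Longrightarrow> smooth_on k U l (\<lambda>_. c)"
  unfolding smooth_on_def by (auto intro: Ck_on_const)

lemma smooth_on_ident:
  "openin (Euclidean_space k) U \<Longrightarrow> smooth_on k U k (\<lambda>x. x)"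
  unfolding smooth_on_def using openin_subset by (auto intro: Ck_on_coordinate)

lemma smooth_on_subset:
  "smooth_on k U l F \<Longrightarrow> U' \<subseteq> U \<Longrightarrow> smooth_on k U' l F"
  unfolding smooth_on_def by (meson Ck_on_subset image_mono order_trans)

lemma smooth_on_compose:
  assumes U: "openin (Euclidean_space k) U" and W: "openin (Euclidean_space l) W"
    and G: "smooth_on k U m G" and F: "smooth_on l W k F" and FU: "F ` W \<subseteq> U"
  shows "smooth_on l W m (G \<circ> F)"
  unfolding smooth_on_def o_def
proof (intro conjI allI impI)
  show "(\<lambda>x. G (F x)) ` W \<subseteq> Rn m"
    using G FU unfolding smooth_on_def by blast
  show "Ck_on r l W (\<lambda>x. G (F x) j)" if "j < m" for j r
    by (rule Ck_on_compose[OF U W FU]) (use F G that in \<open>simp_all add: smooth_on_def\<close>)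
qed

lemma openin_smooth_preimage:
  assumes W: "openin (Euclidean_space l) W" and F: "smooth_on l W k F"
    and V: "openin (Euclidean_space k) V"
  shows "openin (Euclidean_space l) {x \<in> W. F x \<in> V}"
proof -
  have "continuous_map (subtopology (Euclidean_space l) W) (subtopology (Euclidean_space k) (Rn k)) F"
  proof (rule continuous_map_into_Euclidean_subspace)
    show "continuous_map (subtopology (Euclidean_space l) W) euclideanreal (\<lambda>x. F x j)"
      if "j < k" for j
      by (rule Ck_on_continuous[of 0]) (use F that in \<open>simp only: smooth_on_def\<close>)
  qed (use F in \<open>auto simp: smooth_on_def topspace_subtopology_open[OF W]\<close>)
  then have "continuous_map (subtopology (Euclidean_space l) W) (Euclidean_space k) F"
    by (simp only: subtopology_topspace)
  from openin_continuous_map_preimage[OF this V]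
  have "openin (subtopology (Euclidean_space l) W) {x \<in> W. F x \<in> V}"
    unfolding topspace_subtopology_open[OF W] .
  then show ?thesis using W by (rule openin_trans_full)
qed

lemma manifold_smooth_onI:
  assumes "\<And>x. x \<in> U \<Longrightarrow> \<exists>O' W \<phi>. openin (Euclidean_space k) O' \<and> x \<in> O' \<and> O' \<subseteq> U \<and>
             (W, \<phi>) \<in> A \<and> F ` O' \<subseteq> W \<and> smooth_on k O' d (\<phi> \<circ> F)"
  shows "manifold_smooth_on d A k U F"
  unfolding manifold_smooth_on_def
proof
  fix x assume "x \<in> U"
  from assms[OF this] obtain O' W \<phi> where
    "openin (Euclidean_space k) O'" "x \<in> O'" "O' \<subseteq> U"
    "(W, \<phi>) \<in> A" "F ` O' \<subseteq> W" "smooth_on k O' d (\<phi> \<circ> F)" by blast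
  then show "\<exists>O'. openin (Euclidean_space k) O' \<and> x \<in> O' \<and> O' \<subseteq> U \<and>
        (\<exists>(W, \<phi>)\<in>A. F ` O' \<subseteq> W \<and> smooth_on k O' d (\<phi> \<circ> F))"
    by (intro exI[of _ O'] conjI bexI[of _ "(W, \<phi>)"]) simp_all
qed

lemma manifold_smooth_onE:
  assumes "manifold_smooth_on d A k U F" "x \<in> U"
  obtains O' W \<phi> where "openin (Euclidean_space k) O'" "x \<in> O'" "O' \<subseteq> U"
    "(W, \<phi>) \<in> A" "F ` O' \<subseteq> W" "smooth_on k O' d (\<phi> \<circ> F)"
proof -
  obtain O' c where O': "openin (Euclidean_space k) O'" "x \<in> O'" "O' \<subseteq> U"
    and c: "c \<in> A" "case c of (W, \<phi>) \<Rightarrow> F ` O' \<subseteq> W \<and> smooth_on k O' d (\<phi> \<circ> F)"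
    using assms unfolding manifold_smooth_on_def by meson
  obtain W \<phi> where "c = (W, \<phi>)" by (cases c)
  with c that[OF O'] show thesis by simp
qed

lemma manifold_smooth_on_local:
  assumes "\<And>x. x \<in> U \<Longrightarrow> \<exists>O'. x \<in> O' \<and> O' \<subseteq> U \<and> manifold_smooth_on d A k O' F"
  shows "manifold_smooth_on d A k U F"
proof (rule manifold_smooth_onI)
  fix x assume "x \<in> U"
  with assms obtain V where V: "x \<in> V" "V \<subseteq> U" "manifold_smooth_on d A k V F" by blast
  from V(3,1) obtain O' W \<phi> where "openin (Euclidean_space k) O'" "x \<in> O'" "O' \<subseteq> V"
    "(W, \<phi>) \<in> A" "F ` O' \<subseteq> W" "smooth_on k O' d (\<phi> \<circ> F)"
    by (rule manifold_smooth_onE)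
  with V(2) show "\<exists>O' W \<phi>. openin (Euclidean_space k) O' \<and> x \<in> O' \<and> O' \<subseteq> U \<and>
             (W, \<phi>) \<in> A \<and> F ` O' \<subseteq> W \<and> smooth_on k O' d (\<phi> \<circ> F)"
    by blast
qed

lemma manifold_smooth_on_cong:
  assumes F: "manifold_smooth_on d A k U F" and eq: "\<And>y. y \<in> U \<Longrightarrow> F y = G y"
  shows "manifold_smooth_on d A k U G"
proof (rule manifold_smooth_onI)
  fix x assume "x \<in> U"
  with F obtain O' W \<phi> where O': "openin (Euclidean_space k) O'" "x \<in> O'" "O' \<subseteq> U"
    "(W, \<phi>) \<in> A" "F ` O' \<subseteq> W" "smooth_on k O' d (\<phi> \<circ> F)"
    by (rule manifold_smooth_onE)
  have eq': "F y = G y" if "y \<in> O'" for y using that O'(3) eq by blast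
  have "smooth_on k O' d (\<phi> \<circ> G)"
    using smooth_on_cong[OF O'(1), of "\<phi> \<circ> F" "\<phi> \<circ> G"] eq' O'(6) by simp
  moreover have "G ` O' \<subseteq> W" using O'(5) eq' by auto
  ultimately show "\<exists>O' W \<phi>. openin (Euclidean_space k) O' \<and> x \<in> O' \<and> O' \<subseteq> U \<and>
             (W, \<phi>) \<in> A \<and> G ` O' \<subseteq> W \<and> smooth_on k O' d (\<phi> \<circ> G)"
    using O'(1-4) by blast
qed

text \<open>A chart that works for \<open>P\<close> near \<open>F x\<close> works for \<open>P \<circ> F\<close> on the preimage of the neighbourhood,
  which is open by continuity of \<open>F\<close>; there the claim is the one for maps between domains.\<close>

lemma manifold_smooth_on_compose:
  assumes W: "openin (Euclidean_space l) W" and P: "manifold_smooth_on d A k U P"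
    and F: "smooth_on l W k F" and FU: "F ` W \<subseteq> U"
  shows "manifold_smooth_on d A l W (P \<circ> F)"
proof (rule manifold_smooth_onI)
  fix x assume x: "x \<in> W"
  then have "F x \<in> U" using FU by blast
  with P obtain V Y \<phi> where V: "openin (Euclidean_space k) V" "F x \<in> V"
    "(Y, \<phi>) \<in> A" "P ` V \<subseteq> Y" "smooth_on k V d (\<phi> \<circ> P)"
    by (rule manifold_smooth_onE)
  let ?O = "{y \<in> W. F y \<in> V}"
  have O: "openin (Euclidean_space l) ?O" by (rule openin_smooth_preimage[OF W F V(1)])
  have "smooth_on l ?O d ((\<phi> \<circ> P) \<circ> F)"
    by (rule smooth_on_compose[OF V(1) O V(5) smooth_on_subset[OF F]]) auto
  then have "smooth_on l ?O d (\<phi> \<circ> (P \<circ> F))" by (simp only: comp_assoc)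
  moreover have "(P \<circ> F) ` ?O \<subseteq> Y" using V(4) by auto
  moreover have "x \<in> ?O" "?O \<subseteq> W" using x V(2) by auto
  ultimately show "\<exists>O' Y \<phi>. openin (Euclidean_space l) O' \<and> x \<in> O' \<and> O' \<subseteq> W \<and>
             (Y, \<phi>) \<in> A \<and> (P \<circ> F) ` O' \<subseteq> Y \<and> smooth_on l O' d (\<phi> \<circ> (P \<circ> F))"
    using O V(3) by blast
qed

lemma manifold_smooth_on_const:
  assumes A: "smooth_atlas d X A" and c: "c \<in> topspace X" and U: "openin (Euclidean_space k) U"
  shows "manifold_smooth_on d A k U (\<lambda>_. c)"
proof (rule manifold_smooth_onI)
  fix x assume x: "x \<in> U"
  obtain W \<phi> where W: "(W, \<phi>) \<in> A" "c \<in> W"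
    using A c unfolding smooth_atlas_def by blast
  then have "openin (Euclidean_space d) (\<phi> ` W)"
    using A unfolding smooth_atlas_def is_chart_def by blast
  then have "\<phi> c \<in> Rn d" using openin_subset W(2) by blast
  then have "smooth_on k U d (\<phi> \<circ> (\<lambda>_. c))"
    unfolding o_def by (rule smooth_on_const[OF U])
  moreover have "(\<lambda>_. c) ` U \<subseteq> W" using W(2) by auto
  ultimately show "\<exists>O' W \<phi>. openin (Euclidean_space k) O' \<and> x \<in> O' \<and> O' \<subseteq> U \<and>
             (W, \<phi>) \<in> A \<and> (\<lambda>_. c) ` O' \<subseteq> W \<and> smooth_on k O' d (\<phi> \<circ> (\<lambda>_. c))"
    using U x W(1) by blast
qed


section \<open>The diffeology of a manifold and pullback diffeologies\<close>

text \<open>Constants are plots because the charts cover the manifold, locality is built into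
  \<open>manifold_smooth_on\<close>, and reparametrization is \<open>manifold_smooth_on_compose\<close>.\<close>

lemma diffeology_manifold:
  assumes A: "smooth_atlas d X A" and ne: "topspace X \<noteq> {}"
  shows "diffeology (topspace X) (manifold_diffeology d X A)"
proof (rule diffeologyI[OF ne])
  show "manifold_diffeology d X A \<subseteq> parametrizations (topspace X)"
    unfolding manifold_diffeology_def by blast
  show "(k, Rn k, \<lambda>x\<in>Rn k. s) \<in> manifold_diffeology d X A" if s: "s \<in> topspace X" for k s
  proof -
    have "manifold_smooth_on d A k (Rn k) (\<lambda>x\<in>Rn k. s)"
      by (rule manifold_smooth_on_cong[OF manifold_smooth_on_const[OF A s openin_topspace]]) simp
    with s show ?thesis by (simp add: manifold_diffeology_def parametrizations_def)
  qed
next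
  fix k U P
  assume P: "(k, U, P) \<in> parametrizations (topspace X)"
    and loc: "\<And>x. x \<in> U \<Longrightarrow> \<exists>O'. openin (Euclidean_space k) O' \<and> x \<in> O' \<and> O' \<subseteq> U \<and>
                (k, O', restrict P O') \<in> manifold_diffeology d X A"
  have "manifold_smooth_on d A k U P"
  proof (rule manifold_smooth_on_local)
    fix x assume "x \<in> U"
    from loc[OF this] obtain O' where O': "x \<in> O'" "O' \<subseteq> U"
      "manifold_smooth_on d A k O' (restrict P O')"
      unfolding manifold_diffeology_def by blast
    have "manifold_smooth_on d A k O' P"
      by (rule manifold_smooth_on_cong[OF O'(3)]) simp
    with O' show "\<exists>O'. x \<in> O' \<and> O' \<subseteq> U \<and> manifold_smooth_on d A k O' P" by blast
  qed
  with P show "(k, U, P) \<in> manifold_diffeology d X A"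
    unfolding manifold_diffeology_def by blast
next
  fix k U P l W and F :: "(nat \<Rightarrow> real) \<Rightarrow> (nat \<Rightarrow> real)"
  assume P: "(k, U, P) \<in> manifold_diffeology d X A" and W: "openin (Euclidean_space l) W"
    and FU: "F ` W \<subseteq> U" and F: "smooth_on l W k F"
  have "manifold_smooth_on d A k U P" "P \<in> U \<rightarrow>\<^sub>E topspace X"
    using P unfolding manifold_diffeology_def parametrizations_def by blast+
  have "manifold_smooth_on d A l W (compose W P F)"
    by (rule manifold_smooth_on_cong[OF manifold_smooth_on_compose[OF W _ F FU]])
      (use \<open>manifold_smooth_on d A k U P\<close> in \<open>simp_all add: compose_def\<close>)
  moreover have "compose W P F \<in> W \<rightarrow>\<^sub>E topspace X"
    using \<open>P \<in> U \<rightarrow>\<^sub>E topspace X\<close> FU by (auto simp: compose_def PiE_iff)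
  ultimately show "(l, W, compose W P F) \<in> manifold_diffeology d X A"
    using W unfolding manifold_diffeology_def parametrizations_def by blast
qed

definition pullback_diffeology ::
    "'s set \<Rightarrow> ('s \<Rightarrow> 't) \<Rightarrow> 't parametrization set \<Rightarrow> 's parametrization set" where
  "pullback_diffeology S f E = {(k, U, P) \<in> parametrizations S. (k, U, compose U f P) \<in> E}"

text \<open>The bridge to finest diffeologies: smoothness of a map becomes an inclusion of sets of plots, which
  can be checked on a generating family once the right-hand side is a diffeology.\<close>

lemma smooth_maps_iff_pullback:
  assumes "D \<subseteq> parametrizations S"
  shows "f \<in> smooth_maps S D T E \<longleftrightarrow> f \<in> S \<rightarrow>\<^sub>E T \<and> D \<subseteq> pullback_diffeology S f E"
  using assms unfolding smooth_maps_def pullback_diffeology_def by blast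

lemma diffeology_pullback:
  assumes E: "diffeology T E" and f: "f \<in> S \<rightarrow> T" and ne: "S \<noteq> {}"
  shows "diffeology S (pullback_diffeology S f E)"
proof (rule diffeologyI[OF ne])
  show "pullback_diffeology S f E \<subseteq> parametrizations S"
    unfolding pullback_diffeology_def by blast
  show "(k, Rn k, \<lambda>x\<in>Rn k. s) \<in> pullback_diffeology S f E" if s: "s \<in> S" for k s
  proof -
    have "compose (Rn k) f (\<lambda>x\<in>Rn k. s) = (\<lambda>x\<in>Rn k. f s)"
      by (auto simp: compose_def restrict_def)
    moreover have "(k, Rn k, \<lambda>x\<in>Rn k. f s) \<in> E"
      using diffeologyD(3)[OF E] f s by blast
    ultimately show ?thesis
      using s by (simp add: pullback_diffeology_def parametrizations_def)
  qed
next
  fix k U P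
  assume P: "(k, U, P) \<in> parametrizations S"
    and loc: "\<And>x. x \<in> U \<Longrightarrow> \<exists>O'. openin (Euclidean_space k) O' \<and> x \<in> O' \<and> O' \<subseteq> U \<and>
                (k, O', restrict P O') \<in> pullback_diffeology S f E"
  have "(k, U, compose U f P) \<in> E"
  proof (rule diffeologyD(4)[OF E])
    show "(k, U, compose U f P) \<in> parametrizations T"
      using P f by (auto simp: parametrizations_def compose_def PiE_iff Pi_iff)
    fix x assume "x \<in> U"
    from loc[OF this] obtain O' where O': "openin (Euclidean_space k) O'" "x \<in> O'" "O' \<subseteq> U"
      "(k, O', compose O' f (restrict P O')) \<in> E"
      unfolding pullback_diffeology_def by blast
    have "compose O' f (restrict P O') = restrict (compose U f P) O'"
      using O'(3) by (auto simp: compose_def restrict_def fun_eq_iff)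
    with O' show "\<exists>O'. openin (Euclidean_space k) O' \<and> x \<in> O' \<and> O' \<subseteq> U \<and>
        (k, O', restrict (compose U f P) O') \<in> E" by auto
  qed
  with P show "(k, U, P) \<in> pullback_diffeology S f E"
    unfolding pullback_diffeology_def by blast
next
  fix k U P l W and F :: "(nat \<Rightarrow> real) \<Rightarrow> (nat \<Rightarrow> real)"
  assume P: "(k, U, P) \<in> pullback_diffeology S f E" and W: "openin (Euclidean_space l) W"
    and FU: "F ` W \<subseteq> U" and F: "smooth_on l W k F"
  have PS: "P \<in> U \<rightarrow>\<^sub>E S" and PE: "(k, U, compose U f P) \<in> E"
    using P unfolding pullback_diffeology_def parametrizations_def by blast+
  have "compose W f (compose W P F) = compose W (compose U f P) F"
    using FU by (auto simp: compose_def restrict_def fun_eq_iff)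
  then have "(l, W, compose W f (compose W P F)) \<in> E"
    using diffeologyD(5)[OF E PE W FU F] by simp
  moreover have "compose W P F \<in> W \<rightarrow>\<^sub>E S"
    using PS FU by (auto simp: compose_def PiE_iff)
  ultimately show "(l, W, compose W P F) \<in> pullback_diffeology S f E"
    using W by (simp add: pullback_diffeology_def parametrizations_def)
qed


section \<open>Plots of the space of barcodes\<close>

lemma Qmap_in_Bar: "x \<in> Rn (2 * m + n) \<Longrightarrow> Qmap m n x \<in> Bar"
  using quotient_map_Bar_onto by (force simp: quotient_map_Bar_def OrdBar_def)

text \<open>The image of the identity plot of \<open>Rn (2 * m + n)\<close> under inclusion and quotient map.\<close>

lemma Qmap_is_plot:
  "(2 * m + n, Rn (2 * m + n), restrict (Qmap m n) (Rn (2 * m + n))) \<in> Bar_diffeology"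
proof -
  let ?k = "2 * m + n"
  let ?R = "Rn ?k"
  have "smooth_on ?k ?R ?k (\<lambda>x\<in>?R. x)"
    using smooth_on_cong[of ?k ?R "\<lambda>x. x" "\<lambda>x\<in>?R. x" ?k] smooth_on_ident[of ?k ?R] by simp
  then have "(?k, ?R, \<lambda>x\<in>?R. x) \<in> euclidean_diffeology ?k"
    by (simp add: euclidean_diffeology_def parametrizations_def)
  then have "(?k, ?R, compose ?R (ord_incl m n) (\<lambda>x\<in>?R. x)) \<in> sum_diffeology"
    using sum_diffeology_finest(2) unfolding smooth_maps_def by fast
  then have "(?k, ?R, compose ?R quotient_map_Bar (compose ?R (ord_incl m n) (\<lambda>x\<in>?R. x)))
      \<in> Bar_diffeology"
    using Bar_diffeology_finest(2) unfolding smooth_maps_def by fast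
  moreover have "compose ?R quotient_map_Bar (compose ?R (ord_incl m n) (\<lambda>x\<in>?R. x)) =
      restrict (Qmap m n) ?R"
    by (auto simp: compose_def restrict_def fun_eq_iff quotient_map_Bar_def ord_incl_def OrdBar_def)
  ultimately show ?thesis by simp
qed

text \<open>The maps \<open>Qmap m n\<close> generate the diffeology of \<open>Bar\<close>, so smoothness need only be tested on them. For
  the converse direction the diffeologies \<open>?G\<close> on \<open>Bar\<close> and \<open>?H\<close> on ordered barcodes are the successive
  pullbacks of \<open>E\<close>; minimality of the sum diffeology puts it inside \<open>?H\<close>, hence the quotient map is
  smooth to \<open>?G\<close>, and minimality of the quotient diffeology puts \<open>Bar_diffeology\<close> inside \<open>?G\<close>.\<close>

lemma smooth_maps_from_Bar_iff:
  assumes E: "diffeology T E" and V: "V \<in> Bar \<rightarrow>\<^sub>E T"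
  shows "V \<in> smooth_maps Bar Bar_diffeology T E \<longleftrightarrow>
         (\<forall>m n. (2 * m + n, Rn (2 * m + n), compose (Rn (2 * m + n)) V (Qmap m n)) \<in> E)"
    (is "?smooth \<longleftrightarrow> (\<forall>m n. ?VQ m n \<in> E)")
proof
  assume smooth: ?smooth
  show "\<forall>m n. ?VQ m n \<in> E"
  proof (intro allI)
    fix m n
    let ?R = "Rn (2 * m + n)"
    have "(2 * m + n, ?R, compose ?R V (restrict (Qmap m n) ?R)) \<in> E"
      using smooth Qmap_is_plot[of m n] unfolding smooth_maps_def by fast
    moreover have "compose ?R V (restrict (Qmap m n) ?R) = compose ?R V (Qmap m n)"
      by (auto simp: compose_def restrict_def fun_eq_iff)
    ultimately show "?VQ m n \<in> E" by simp
  qed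
next
  assume VQ: "\<forall>m n. ?VQ m n \<in> E"
  have VT: "V \<in> Bar \<rightarrow> T" using V by (auto simp: PiE_iff)
  let ?q = quotient_map_Bar
  let ?G = "pullback_diffeology Bar V E"
  have G: "diffeology Bar ?G"
    by (rule diffeology_pullback[OF E VT diffeologyD(1)[OF Bar_diffeology_finest(1)]])
  have q: "?q \<in> OrdBar \<rightarrow>\<^sub>E Bar"
    using Bar_diffeology_finest(2) unfolding smooth_maps_def by blast
  then have q': "?q \<in> OrdBar \<rightarrow> Bar" by (auto simp: PiE_iff)
  let ?H = "pullback_diffeology OrdBar ?q ?G"
  have H: "diffeology OrdBar ?H"
    by (rule diffeology_pullback[OF G q' diffeologyD(1)[OF sum_diffeology_finest(1)]])
  have incl: "ord_incl m n \<in> smooth_maps (Rn (2 * m + n)) (euclidean_diffeology (2 * m + n)) OrdBar ?H"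
    for m n
  proof -
    let ?R = "Rn (2 * m + n)"
    have "(k, U, compose U (ord_incl m n) P) \<in> ?H"
      if P: "(k, U, P) \<in> euclidean_diffeology (2 * m + n)" for k U P
    proof -
      have U: "openin (Euclidean_space k) U" and PR: "P \<in> U \<rightarrow>\<^sub>E ?R"
        and sm: "smooth_on k U (2 * m + n) P"
        using P unfolding euclidean_diffeology_def parametrizations_def by blast+
      have PR': "P x \<in> ?R" if "x \<in> U" for x using PR that by blast
      have "(k, U, compose U (compose ?R V (Qmap m n)) P) \<in> E"
        by (rule diffeologyD(5)[OF E VQ[rule_format] U _ sm]) (use PR' in blast)
      moreover have "compose U (compose ?R V (Qmap m n)) P =
          compose U V (compose U ?q (compose U (ord_incl m n) P))"
        using PR' by (auto simp: compose_def restrict_def fun_eq_iff quotient_map_Bar_def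
            ord_incl_def OrdBar_def)
      moreover have "compose U (ord_incl m n) P \<in> U \<rightarrow>\<^sub>E OrdBar"
        using PR' by (auto simp: compose_def ord_incl_def OrdBar_def)
      moreover from this have "compose U ?q (compose U (ord_incl m n) P) \<in> U \<rightarrow>\<^sub>E Bar"
        using q' by (auto simp: compose_def PiE_iff Pi_iff)
      ultimately show ?thesis
        using U by (simp add: pullback_diffeology_def parametrizations_def)
    qed
    moreover have "ord_incl m n \<in> ?R \<rightarrow>\<^sub>E OrdBar"
      by (auto simp: ord_incl_def OrdBar_def)
    ultimately show ?thesis unfolding smooth_maps_def by blast
  qed
  have "sum_diffeology \<subseteq> ?H"
    by (rule sum_diffeology_finest(3)[OF H]) (use incl in blast)
  then have "?q \<in> smooth_maps OrdBar sum_diffeology Bar ?G"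
    using q smooth_maps_iff_pullback[OF diffeologyD(2)[OF sum_diffeology_finest(1)]] by blast
  then have "Bar_diffeology \<subseteq> ?G"
    by (rule Bar_diffeology_finest(3)[OF G])
  then show ?smooth
    using V smooth_maps_iff_pullback[OF diffeologyD(2)[OF Bar_diffeology_finest(1)]] by blast
qed

lemma infinitely_differentiable_iff:
  "(\<forall>D \<in> Bar. infinitely_differentiable_at d A V D) \<longleftrightarrow>
   (\<forall>m n. manifold_smooth_on d A (2 * m + n) (Rn (2 * m + n)) (V \<circ> Qmap m n))"
proof
  assume diff: "\<forall>D \<in> Bar. infinitely_differentiable_at d A V D"
  show "\<forall>m n. manifold_smooth_on d A (2 * m + n) (Rn (2 * m + n)) (V \<circ> Qmap m n)"
  proof (intro allI manifold_smooth_on_local)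
    fix m n x assume x: "x \<in> Rn (2 * m + n)"
    then obtain U where "openin (Euclidean_space (2 * m + n)) U" "x \<in> U"
      "manifold_smooth_on d A (2 * m + n) U (V \<circ> Qmap m n)"
      using diff Qmap_in_Bar[OF x] unfolding infinitely_differentiable_at_def by blast
    then show "\<exists>O'. x \<in> O' \<and> O' \<subseteq> Rn (2 * m + n) \<and>
        manifold_smooth_on d A (2 * m + n) O' (V \<circ> Qmap m n)"
      using openin_subset by blast
  qed
next
  assume "\<forall>m n. manifold_smooth_on d A (2 * m + n) (Rn (2 * m + n)) (V \<circ> Qmap m n)"
  then show "\<forall>D \<in> Bar. infinitely_differentiable_at d A V D"
    unfolding infinitely_differentiable_at_def using openin_topspace by blast
qed

lemma compose_in_manifold_diffeology_iff:
  assumes V: "V \<in> S \<rightarrow> topspace X" and P: "P ` U \<subseteq> S" and U: "openin (Euclidean_space k) U"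
  shows "(k, U, compose U V P) \<in> manifold_diffeology d X A \<longleftrightarrow> manifold_smooth_on d A k U (V \<circ> P)"
proof -
  have "compose U V P \<in> U \<rightarrow>\<^sub>E topspace X"
    using V P by (auto simp: compose_def Pi_iff)
  moreover have "manifold_smooth_on d A k U (compose U V P) \<longleftrightarrow> manifold_smooth_on d A k U (V \<circ> P)"
    using manifold_smooth_on_cong[of d A k U "compose U V P" "V \<circ> P"]
      manifold_smooth_on_cong[of d A k U "V \<circ> P" "compose U V P"]
    by (auto simp: compose_def)
  ultimately show ?thesis
    using U by (simp add: manifold_diffeology_def parametrizations_def)
qed

theorem corollary3p21:
  fixes d :: nat and \<N> :: "'a topology" and A :: "'a chart set"
  assumes "smooth_manifold d \<N> A"
  shows "smooth_maps Bar Bar_diffeology (topspace \<N>) (manifold_diffeology d \<N> A) =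
         {V \<in> Bar \<rightarrow>\<^sub>E topspace \<N>. \<forall>D \<in> Bar. infinitely_differentiable_at d A V D}"
proof -
  have A: "smooth_atlas d \<N> A" using assms by (simp add: smooth_manifold_def)
  have "V \<in> smooth_maps Bar Bar_diffeology (topspace \<N>) (manifold_diffeology d \<N> A) \<longleftrightarrow>
        (\<forall>D \<in> Bar. infinitely_differentiable_at d A V D)" if V: "V \<in> Bar \<rightarrow>\<^sub>E topspace \<N>" for V
  proof -
    have V': "V \<in> Bar \<rightarrow> topspace \<N>" using V by (auto simp: PiE_iff)
    have "Bar \<noteq> {}" by (rule diffeologyD(1)[OF Bar_diffeology_finest(1)])
    \<comment> \<open>An empty manifold carries no diffeology, but neither is there a map from \<open>Bar\<close> to it.\<close>
    then have "topspace \<N> \<noteq> {}" using V' by blast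
    then have "diffeology (topspace \<N>) (manifold_diffeology d \<N> A)"
      by (rule diffeology_manifold[OF A])
    note smooth_maps_from_Bar_iff[OF this V]
    also have "(\<forall>m n. (2 * m + n, Rn (2 * m + n), compose (Rn (2 * m + n)) V (Qmap m n))
          \<in> manifold_diffeology d \<N> A) \<longleftrightarrow>
        (\<forall>m n. manifold_smooth_on d A (2 * m + n) (Rn (2 * m + n)) (V \<circ> Qmap m n))"
      by (intro all_cong1 compose_in_manifold_diffeology_iff[OF V'] openin_topspace)
        (use Qmap_in_Bar in blast)
    also have "\<dots> \<longleftrightarrow> (\<forall>D \<in> Bar. infinitely_differentiable_at d A V D)"
      by (rule infinitely_differentiable_iff[symmetric])
    finally show ?thesis .
  qed
  then show ?thesis unfolding smooth_maps_def by blast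
qed

end
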